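(* Let $S=k[x_1,\ldots,x_n]$ be a polynomial ring over a field $k$. Let $u=x_1x_i$, $v=x_jx_r$ ($1<i\le n$, $j<r\le n$) with $j\geq 2$, and $I=(L(u,v))$. Then $\mathrm{depth}(S/I)=1$ if and only if $x_{i-1}x_n\geq_{lex}v$.
   Context: Monomials are ordered by the lexicographic order with $x_1>x_2>\cdots>x_n$. For squarefree monomials $u\geq_{lex}v$ of degree $2$, $L(u,v)=\{w: w \text{ a squarefree monomial of degree } 2,\ u\geq_{lex}w\geq_{lex}v\}$. Depth is taken with respect to the graded maximal ideal $(x_1,\ldots,x_n)$. *)

theory Defs
  imports
    "HOL-Algebra.QuotRing"
    "HOL-Algebra.Module"
    "HOL-Library.Poly_Mapping"
    "HOL-Library.Extended_Nat"
begin

text \<open>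
  A monomial is its exponent vector, of type \<open>nat \<Rightarrow>\<^sub>0 nat\<close>, and a polynomial is a finitely
  supported function from monomials to coefficients. The product on \<open>\<Rightarrow>\<^sub>0\<close> is convolution, so
  the type carries the usual ring operations of a polynomial ring in variables indexed by
  all natural numbers; the ring $k[x_1,\dots,x_n]$ is its subring in which only the variables
  of index \<open>1, \<dots>, n\<close> occur. The product of monomials is addition of exponent vectors.
\<close>

type_synonym mono = "nat \<Rightarrow>\<^sub>0 nat"
type_synonym 'k mpoly = "mono \<Rightarrow>\<^sub>0 'k"

definition monomials :: "nat \<Rightarrow> mono set" where
  "monomials n = {w. Poly_Mapping.keys w \<subseteq> {1..n}}"

definition poly_ring :: "nat \<Rightarrow> 'k::field mpoly ring" where
  "poly_ring n =
    \<lparr>carrier = {p. Poly_Mapping.keys p \<subseteq> monomials n},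
     mult = (*), one = 1, zero = 0, add = (+)\<rparr>"

definition xvar :: "nat \<Rightarrow> mono" where
  "xvar i = Poly_Mapping.single i 1"

definition of_mono :: "mono \<Rightarrow> 'k::field mpoly" where
  "of_mono w = Poly_Mapping.single w 1"

definition graded_max_ideal :: "nat \<Rightarrow> 'k::field mpoly set" where
  "graded_max_ideal n = Idl\<^bsub>poly_ring n\<^esub> ((\<lambda>i. of_mono (xvar i)) ` {1..n})"

definition squarefree_monomials :: "nat \<Rightarrow> nat \<Rightarrow> mono set" where
  "squarefree_monomials n d =
    {w \<in> monomials n. (\<forall>i. Poly_Mapping.lookup w i \<le> 1) \<and>
       (\<Sum>i=1..n. Poly_Mapping.lookup w i) = d}"

text \<open>
  The library order \<open>\<le>\<close> on \<open>nat \<Rightarrow>\<^sub>0 nat\<close> compares values at the smallest index where the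
  arguments differ (it is not the pointwise order), so it is the lexicographic order with
  $x_1 > x_2 > \dots > x_n$.
\<close>

lemma mono_less_iff:
  "w < (w' :: mono) \<longleftrightarrow>
    (\<exists>k. Poly_Mapping.lookup w k < Poly_Mapping.lookup w' k \<and>
      (\<forall>l<k. Poly_Mapping.lookup w l = Poly_Mapping.lookup w' l))"
  by transfer (simp add: less_fun_def)

definition lex_segment :: "nat \<Rightarrow> mono \<Rightarrow> mono \<Rightarrow> mono set" where
  "lex_segment n u v = {w \<in> squarefree_monomials n 2. w \<le> u \<and> v \<le> w}"

definition lex_segment_ideal :: "nat \<Rightarrow> mono \<Rightarrow> mono \<Rightarrow> 'k::field mpoly set" where
  "lex_segment_ideal n u v = Idl\<^bsub>poly_ring n\<^esub> (of_mono ` lex_segment n u v)"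

text \<open>The submodule $(f_1,\dots,f_r)M$; one summand for each $f_i$ is enough to reach all of it.\<close>

definition list_smult ::
  "('a, 'c) ring_scheme \<Rightarrow> ('a, 'b, 'd) module_scheme \<Rightarrow> 'a list \<Rightarrow> 'b set" where
  "list_smult R M fs =
    {(\<Oplus>\<^bsub>M\<^esub>i\<in>{..<length fs}. (fs ! i) \<odot>\<^bsub>M\<^esub> m i) | m. m \<in> {..<length fs} \<rightarrow> carrier M}"

text \<open>
  Multiplication by $f_{i+1}$ is injective on $M/(f_1,\dots,f_i)M$ for every $i$, and
  $M \neq (f_1,\dots,f_r)M$. Injectivity on the quotient is written out in $M$.
\<close>

definition regular_sequence ::
  "('a, 'c) ring_scheme \<Rightarrow> ('a, 'b, 'd) module_scheme \<Rightarrow> 'a list \<Rightarrow> bool" where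
  "regular_sequence R M fs \<longleftrightarrow>
    set fs \<subseteq> carrier R \<and>
    (\<forall>i<length fs. \<forall>m\<in>carrier M.
       (fs ! i) \<odot>\<^bsub>M\<^esub> m \<in> list_smult R M (take i fs) \<longrightarrow> m \<in> list_smult R M (take i fs)) \<and>
    list_smult R M fs \<noteq> carrier M"

text \<open>
  The depth of \<open>M\<close> with respect to an ideal \<open>\<aa>\<close> is the supremum of the lengths of the
  \<open>M\<close>-regular sequences in \<open>\<aa>\<close>. The supremum is over a nonempty set (the empty sequence)
  whenever \<open>M\<close> is nonzero.
\<close>

definition depth ::
  "('a, 'c) ring_scheme \<Rightarrow> 'a set \<Rightarrow> ('a, 'b, 'd) module_scheme \<Rightarrow> enat" where
  "depth R \<aa> M = (SUP fs \<in> {fs. set fs \<subseteq> \<aa> \<and> regular_sequence R M fs}. enat (length fs))"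

definition quot_module :: "('a, 'c) ring_scheme \<Rightarrow> 'a set \<Rightarrow> ('a, 'a set) module" where
  "quot_module R I =
    \<lparr>carrier = carrier (R Quot I), mult = mult (R Quot I), one = one (R Quot I),
     zero = zero (R Quot I), add = add (R Quot I),
     smult = (\<lambda>r X. (I +>\<^bsub>R\<^esub> r) \<otimes>\<^bsub>R Quot I\<^esub> X)\<rparr>"

lemma monomials_zero: "0 \<in> monomials n"
  by (simp add: monomials_def)

lemma monomials_add: "a \<in> monomials n \<Longrightarrow> b \<in> monomials n \<Longrightarrow> a + b \<in> monomials n"
  using Poly_Mapping.keys_add[of a b] by (auto simp: monomials_def)

lemma poly_ring_cring: "cring (poly_ring n :: 'k::field mpoly ring)"
proof (rule cringI)
  show "abelian_group (poly_ring n :: 'k mpoly ring)"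
  proof (rule abelian_groupI)
    fix x y :: "'k mpoly"
    assume "x \<in> carrier (poly_ring n)" "y \<in> carrier (poly_ring n)"
    then show "x \<oplus>\<^bsub>poly_ring n\<^esub> y \<in> carrier (poly_ring n)"
      using Poly_Mapping.keys_add[of x y] by (auto simp: poly_ring_def)
  next
    fix x :: "'k mpoly"
    assume "x \<in> carrier (poly_ring n)"
    then show "\<exists>y\<in>carrier (poly_ring n). y \<oplus>\<^bsub>poly_ring n\<^esub> x = \<zero>\<^bsub>poly_ring n\<^esub>"
      by (intro bexI[of _ "- x"]) (auto simp: poly_ring_def)
  qed (auto simp: poly_ring_def add_ac)
  show "Group.comm_monoid (poly_ring n :: 'k mpoly ring)"
  proof (rule comm_monoidI)
    fix x y :: "'k mpoly"
    assume "x \<in> carrier (poly_ring n)" "y \<in> carrier (poly_ring n)"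
    then show "x \<otimes>\<^bsub>poly_ring n\<^esub> y \<in> carrier (poly_ring n)"
      using Poly_Mapping.keys_mult[of x y] monomials_add[of _ n]
      by (fastforce simp: poly_ring_def)
  qed (auto simp: poly_ring_def mult_ac monomials_zero)
qed (auto simp: poly_ring_def distrib_right)

lemma quot_module_module:
  assumes "cring R" "ideal I R"
  shows "Module.module R (quot_module R I)"
proof -
  interpret R: cring R by fact
  interpret ideal I R by fact
  interpret Q: cring "R Quot I" by (rule quotient_is_cring[OF \<open>cring R\<close>])
  interpret h: ring_hom_ring R "R Quot I" "(+>\<^bsub>R\<^esub>) I"
    by (rule rcos_ring_hom_ring)
  show ?thesis
  proof (rule Module.moduleI)
    show "abelian_group (quot_module R I)"
      by (rule abelian_groupI)
        (auto simp: quot_module_def Q.a_ac intro: Q.a_inv_closed Q.l_neg)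
  qed (auto simp: quot_module_def Q.l_distr Q.r_distr Q.m_assoc R.is_cring simp del: FactRing_simps)
qed

end

theory Submission
  imports Defs
begin

text \<open>
  The ideal is the edge ideal of a graph on \<open>{1..n}\<close>: its generators $x_a x_b$ are the edges.
  Call a set of vertices independent if it contains no edge. A monomial lies outside the ideal
  exactly when the set of its variables is independent, so a polynomial lies in the ideal iff
  its restriction to every independent set \<open>F\<close> (all variables outside \<open>F\<close> put to $0$) vanishes
  (\<open>edge_ideal_iff\<close>). Every statement about $S/I$ below is checked on these restrictions, which
  live in polynomial rings, that is, in integral domains.

  The depth is decided by the complement graph, whose edges are the independent pairs.

  \<^item> The depth is at least $1$, as the sum of all variables restricts to a nonzero linear form on
    every nonempty independent set and so is a nonzerodivisor (\<open>sum_var_nonzerodivisor\<close>).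

  \<^item> If a set \<open>A\<close> of vertices is separated from its complement in the complement graph, then every
    independent set lies on one side. Geometrically $S/I$ describes two closed sets that meet only
    in the origin; the idempotent "one on \<open>A\<close>, zero on the other side" is not in $S/I$, but it is
    carried into $S/I$ by every element of the maximal ideal. This prevents a regular sequence
    of length $2$ (\<open>length_regular_sequence_le_one\<close>).

  \<^item> If the complement graph is connected, let $f$ be the sum of all variables and $g$ the sum of
    the variables in a set \<open>Q\<close> such that every independent set extends to one that meets both \<open>Q\<close>
    and the complement of \<open>Q\<close>. On each such extended set $f$ and $g$ are coprime, so
    $g h \in (f) + I$ gives a quotient of $h$ by $f$ there. These quotients agree on common
    nonempty subsets by cancelling $f$, and their constant terms agree by connectedness, so they
    glue to one polynomial $p$ with $h - f p \in I$. Hence $f, g$ is a regular sequence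
    (\<open>regular_sequence_sum_vars\<close>).

  For the lexsegment ideal, if $x_{i-1} x_n \geq v$, then $\{1, \dots, i-1\}$ is separated from
  $\{i, \dots, n\}$: the complement graph joins $1$ to $2, \dots, i-1$ only, and all pairs that cross
  are edges. Otherwise $\{i-1, n\}$ is independent, $i - 1$ is joined to $1$ and every vertex from $i$
  on is joined to $n$, so the complement graph is connected; \<open>Q = {2..n - 1}\<close> is then a possible choice.
\<close>

section \<open>Substitution homomorphisms of polynomials\<close>

abbreviation var :: "nat \<Rightarrow> 'k::field mpoly" where
  "var i \<equiv> of_mono (xvar i)"

definition mono_subst :: "(nat \<Rightarrow> 'k::field mpoly) \<Rightarrow> mono \<Rightarrow> 'k mpoly" where
  "mono_subst \<theta> w = (\<Prod>i\<in>Poly_Mapping.keys w. \<theta> i ^ Poly_Mapping.lookup w i)"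

definition poly_subst :: "(nat \<Rightarrow> 'k::field mpoly) \<Rightarrow> 'k mpoly \<Rightarrow> 'k mpoly" where
  "poly_subst \<theta> p =
    (\<Sum>w\<in>Poly_Mapping.keys p. Poly_Mapping.single 0 (Poly_Mapping.lookup p w) * mono_subst \<theta> w)"

lemma mono_subst_superset:
  assumes "finite A" "Poly_Mapping.keys w \<subseteq> A"
  shows "mono_subst \<theta> w = (\<Prod>i\<in>A. \<theta> i ^ Poly_Mapping.lookup w i)"
  unfolding mono_subst_def
  by (rule prod.mono_neutral_left) (use assms in \<open>auto simp: in_keys_iff\<close>)

lemma mono_subst_add: "mono_subst \<theta> (w + w') = mono_subst \<theta> w * mono_subst \<theta> w'"
proof -
  let ?A = "Poly_Mapping.keys w \<union> Poly_Mapping.keys w'"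
  have "mono_subst \<theta> (w + w') = (\<Prod>i\<in>?A. \<theta> i ^ Poly_Mapping.lookup (w + w') i)"
    by (rule mono_subst_superset) (use Poly_Mapping.keys_add[of w w'] in auto)
  also have "\<dots> = (\<Prod>i\<in>?A. \<theta> i ^ Poly_Mapping.lookup w i) * (\<Prod>i\<in>?A. \<theta> i ^ Poly_Mapping.lookup w' i)"
    by (simp add: lookup_add power_add prod.distrib)
  also have "\<dots> = mono_subst \<theta> w * mono_subst \<theta> w'"
    by (subst (1 2) mono_subst_superset[of ?A]) auto
  finally show ?thesis .
qed

lemma poly_subst_zero [simp]: "poly_subst \<theta> 0 = 0"
  by (simp add: poly_subst_def)

lemma poly_subst_add: "poly_subst \<theta> (p + q) = poly_subst \<theta> p + poly_subst \<theta> q"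
  unfolding poly_subst_def
  by (rule setsum_keys_plus_distrib) (simp_all add: single_add distrib_right)

lemma poly_subst_single: "poly_subst \<theta> (Poly_Mapping.single w c) = Poly_Mapping.single 0 c * mono_subst \<theta> w"
  by (simp add: poly_subst_def)

lemma poly_subst_sum: "poly_subst \<theta> (sum f A) = (\<Sum>x\<in>A. poly_subst \<theta> (f x))"
  by (induction A rule: infinite_finite_induct) (simp_all add: poly_subst_add)

lemma poly_subst_diff: "poly_subst \<theta> (p - q) = poly_subst \<theta> p - poly_subst \<theta> q"
  using poly_subst_add[of \<theta> "p - q" q] by simp

lemma poly_as_sum:
  fixes p :: "'k::field mpoly"
  shows "p = (\<Sum>w\<in>Poly_Mapping.keys p. Poly_Mapping.single w (Poly_Mapping.lookup p w))"
  by (rule poly_mapping_eqI) (simp add: lookup_sum lookup_single when_def in_keys_iff)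

lemma poly_subst_mult: "poly_subst \<theta> (p * q) = poly_subst \<theta> p * poly_subst \<theta> q"
proof -
  let ?s = "\<lambda>p w. Poly_Mapping.single w (Poly_Mapping.lookup p w)"
  have single: "poly_subst \<theta> (?s p w * ?s q w') = poly_subst \<theta> (?s p w) * poly_subst \<theta> (?s q w')" for w w'
  proof -
    have "Poly_Mapping.single 0 (Poly_Mapping.lookup p w * Poly_Mapping.lookup q w') =
        Poly_Mapping.single (0::mono) (Poly_Mapping.lookup p w) * Poly_Mapping.single 0 (Poly_Mapping.lookup q w')"
      by (simp add: mult_single)
    then show ?thesis
      unfolding mult_single[of w _ w'] poly_subst_single mono_subst_add by (simp only: mult_ac)
  qed
  have "p * q = (\<Sum>w\<in>Poly_Mapping.keys p. \<Sum>w'\<in>Poly_Mapping.keys q. ?s p w * ?s q w')"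
    by (simp only: poly_as_sum[symmetric] flip: sum_product)
  then have "poly_subst \<theta> (p * q) =
      (\<Sum>w\<in>Poly_Mapping.keys p. \<Sum>w'\<in>Poly_Mapping.keys q. poly_subst \<theta> (?s p w) * poly_subst \<theta> (?s q w'))"
    by (simp only: poly_subst_sum single)
  also have "\<dots> = poly_subst \<theta> p * poly_subst \<theta> q"
    by (simp only: poly_as_sum[symmetric] flip: sum_product poly_subst_sum)
  finally show ?thesis .
qed

lemma of_mono_eq_prod_var: "of_mono w = mono_subst var w"
proof -
  have pow: "var i ^ k = (of_mono (Poly_Mapping.single i k) :: 'a mpoly)" for i k
    by (induction k) (simp_all add: of_mono_def xvar_def mult_single flip: single_add)
  have prod: "(\<Prod>i\<in>A. of_mono (g i)) = (of_mono (sum g A) :: 'a mpoly)" if "finite A" for A :: "nat set" and g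
    using that by (induction A) (simp_all add: of_mono_def mult_single)
  have "w = (\<Sum>i\<in>Poly_Mapping.keys w. Poly_Mapping.single i (Poly_Mapping.lookup w i))"
    by (rule poly_mapping_eqI) (simp add: lookup_sum lookup_single when_def in_keys_iff)
  then have "of_mono w = (of_mono (\<Sum>i\<in>Poly_Mapping.keys w. Poly_Mapping.single i (Poly_Mapping.lookup w i)) :: 'a mpoly)"
    by (rule arg_cong)
  then show ?thesis
    by (simp only: mono_subst_def pow prod finite_keys)
qed

lemma dvd_prod_power_diff:
  fixes f g :: "'a \<Rightarrow> 'b::comm_ring_1"
  assumes "\<And>i. d dvd f i - g i"
  shows "d dvd (\<Prod>i\<in>A. f i ^ e i) - (\<Prod>i\<in>A. g i ^ e i)"
proof -
  have mult: "d dvd a * b - a' * b'" if "d dvd a - a'" "d dvd b - b'" for a b a' b'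
  proof -
    have "a * b - a' * b' = (a - a') * b + a' * (b - b')" by (simp add: algebra_simps)
    with that show ?thesis by (metis dvd_add dvd_mult dvd_mult2)
  qed
  have "d dvd f i ^ k - g i ^ k" for i k
    by (induction k) (simp_all add: mult assms)
  then show ?thesis
    by (induction A rule: infinite_finite_induct) (simp_all add: mult)
qed

text \<open>
  A substitution that changes each variable by a multiple of \<open>d\<close> does not leave the residue class
  modulo \<open>d\<close>. In particular a polynomial killed by such a substitution is divisible by \<open>d\<close>, which
  replaces division with remainder by a linear form.
\<close>

lemma dvd_diff_poly_subst:
  assumes "\<And>i. d dvd var i - \<theta> i"
  shows "d dvd p - poly_subst \<theta> p"
proof -
  have "p = (\<Sum>w\<in>Poly_Mapping.keys p. Poly_Mapping.single 0 (Poly_Mapping.lookup p w) * of_mono w)"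
    by (rule trans[OF poly_as_sum]) (simp add: of_mono_def mult_single)
  from arg_cong[OF this, of "\<lambda>q. q - poly_subst \<theta> p"]
  have "p - poly_subst \<theta> p = (\<Sum>w\<in>Poly_Mapping.keys p.
      Poly_Mapping.single 0 (Poly_Mapping.lookup p w) * (of_mono w - mono_subst \<theta> w))"
    by (simp only: poly_subst_def sum_subtractf right_diff_distrib)
  moreover have "d dvd of_mono w - mono_subst \<theta> w" for w
    using dvd_prod_power_diff[of d var \<theta> "Poly_Mapping.lookup w" "Poly_Mapping.keys w"] assms
    by (subst of_mono_eq_prod_var) (simp add: mono_subst_def)
  ultimately show ?thesis by (simp add: dvd_sum)
qed

lemma keys_xvar [simp]: "Poly_Mapping.keys (xvar i) = {i}"
  by (simp add: xvar_def)

lemma poly_subst_var [simp]: "poly_subst \<theta> (var i) = \<theta> i"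
  by (simp add: of_mono_def poly_subst_single mono_subst_def) (simp add: xvar_def)

section \<open>Restriction to a set of variables\<close>

definition restrict_vars :: "nat set \<Rightarrow> 'k::field mpoly \<Rightarrow> 'k mpoly" where
  "restrict_vars F = poly_subst (\<lambda>i. if i \<in> F then var i else 0)"

lemma restrict_vars_single:
  "restrict_vars F (Poly_Mapping.single w c :: 'k::field mpoly) =
    (if Poly_Mapping.keys w \<subseteq> F then Poly_Mapping.single w c else 0)"
proof (cases "Poly_Mapping.keys w \<subseteq> F")
  case True
  then have "mono_subst (\<lambda>i. if i \<in> F then var i else 0) w = (of_mono w :: 'k mpoly)"
    by (subst of_mono_eq_prod_var[of w]) (auto simp: mono_subst_def intro!: prod.cong)
  with True show ?thesis
    by (simp add: restrict_vars_def poly_subst_single of_mono_def mult_single)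
next
  case False
  then have "mono_subst (\<lambda>i. if i \<in> F then var i else 0) w = (0 :: 'k mpoly)"
    by (auto simp: mono_subst_def in_keys_iff)
  with False show ?thesis
    by (simp add: restrict_vars_def poly_subst_single)
qed

text \<open>
  Putting the variables outside \<open>F\<close> to $0$ deletes the monomials that involve one of them and keeps
  all other terms. So the same operation is a ring homomorphism and is computed coefficientwise.
\<close>

lemma lookup_restrict_vars:
  "Poly_Mapping.lookup (restrict_vars F p) w =
    (if Poly_Mapping.keys w \<subseteq> F then Poly_Mapping.lookup p w else 0)"
proof -
  have "restrict_vars F p = (\<Sum>w\<in>Poly_Mapping.keys p. restrict_vars F (Poly_Mapping.single w (Poly_Mapping.lookup p w)))"
    using arg_cong[OF poly_as_sum[of p], of "restrict_vars F"]
    by (simp only: restrict_vars_def poly_subst_sum)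
  then have "Poly_Mapping.lookup (restrict_vars F p) w = (\<Sum>w'\<in>Poly_Mapping.keys p.
      Poly_Mapping.lookup (restrict_vars F (Poly_Mapping.single w' (Poly_Mapping.lookup p w'))) w)"
    by (simp only: lookup_sum)
  also have "\<dots> = (\<Sum>w'\<in>Poly_Mapping.keys p.
      if w' = w then if Poly_Mapping.keys w \<subseteq> F then Poly_Mapping.lookup p w else 0 else 0)"
    by (intro sum.cong refl) (auto simp: restrict_vars_single lookup_single when_def)
  finally show ?thesis
    by (simp add: in_keys_iff)
qed

lemma restrict_vars_zero [simp]: "restrict_vars F 0 = 0"
  and restrict_vars_add: "restrict_vars F (p + q) = restrict_vars F p + restrict_vars F q"
  and restrict_vars_diff: "restrict_vars F (p - q) = restrict_vars F p - restrict_vars F q"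
  and restrict_vars_mult: "restrict_vars F (p * q) = restrict_vars F p * restrict_vars F q"
  and restrict_vars_sum: "restrict_vars F (sum f A) = (\<Sum>x\<in>A. restrict_vars F (f x))"
  by (simp_all add: restrict_vars_def poly_subst_add poly_subst_diff poly_subst_mult poly_subst_sum)

lemma restrict_vars_var: "restrict_vars F (var i) = (if i \<in> F then var i else 0)"
  by (simp add: restrict_vars_def)

lemma restrict_vars_restrict_vars: "restrict_vars F (restrict_vars G p) = restrict_vars (F \<inter> G) p"
  by (rule poly_mapping_eqI) (auto simp: lookup_restrict_vars)

lemma restrict_vars_sum_var:
  "finite A \<Longrightarrow> restrict_vars F (\<Sum>i\<in>A. var i) = (\<Sum>i\<in>A \<inter> F. var i)"
  by (simp add: restrict_vars_sum restrict_vars_var sum.inter_restrict)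

lemma sum_var_nonzero:
  assumes "finite A" "A \<noteq> {}"
  shows "(\<Sum>i\<in>A. var i) \<noteq> (0 :: 'k::field mpoly)"
proof -
  obtain a where "a \<in> A" using assms by auto
  have "restrict_vars {a} (\<Sum>i\<in>A. var i) = (var a :: 'k mpoly)"
    using \<open>a \<in> A\<close> assms by (subst restrict_vars_sum_var) auto
  moreover have "(var a :: 'k mpoly) \<noteq> 0"
    by (metis lookup_single_eq lookup_zero of_mono_def one_neq_zero)
  ultimately show ?thesis by force
qed

text \<open>
  The constant term is the restriction to the empty set of variables, hence multiplicative.
\<close>

lemma lookup_mult_zero:
  "Poly_Mapping.lookup (p * q) 0 = Poly_Mapping.lookup p 0 * Poly_Mapping.lookup (q :: 'k::field mpoly) 0"
proof -
  have "restrict_vars {} p = Poly_Mapping.single 0 (Poly_Mapping.lookup p 0)" for p :: "'k mpoly"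
    by (rule poly_mapping_eqI) (auto simp: lookup_restrict_vars lookup_single when_def)
  from this[of "p * q"] this[of p] this[of q] restrict_vars_mult[of "{}" p q]
  have "Poly_Mapping.single 0 (Poly_Mapping.lookup (p * q) 0) =
      Poly_Mapping.single (0::mono) (Poly_Mapping.lookup p 0 * Poly_Mapping.lookup q 0)"
    by (simp add: mult_single)
  then show ?thesis by (metis lookup_single_eq)
qed

section \<open>The polynomial ring and its graded maximal ideal\<close>

lemma carrier_poly_ring:
  "p \<in> carrier (poly_ring n) \<longleftrightarrow> (\<forall>w\<in>Poly_Mapping.keys p. Poly_Mapping.keys w \<subseteq> {1..n})"
  by (auto simp: poly_ring_def monomials_def)

lemma poly_ring_simps [simp]:
  "mult (poly_ring n) = (*)" "add (poly_ring n) = (+)" "one (poly_ring n) = 1" "zero (poly_ring n) = 0"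
  by (simp_all add: poly_ring_def)

lemma poly_ring_closed [simp, intro]:
  fixes p q :: "'k::field mpoly"
  shows poly_ring_zero: "(0 :: 'k mpoly) \<in> carrier (poly_ring n)"
    and poly_ring_one: "(1 :: 'k mpoly) \<in> carrier (poly_ring n)"
    and poly_ring_add: "\<lbrakk>p \<in> carrier (poly_ring n); q \<in> carrier (poly_ring n)\<rbrakk> \<Longrightarrow> p + q \<in> carrier (poly_ring n)"
    and poly_ring_diff: "\<lbrakk>p \<in> carrier (poly_ring n); q \<in> carrier (poly_ring n)\<rbrakk> \<Longrightarrow> p - q \<in> carrier (poly_ring n)"
    and poly_ring_mult: "\<lbrakk>p \<in> carrier (poly_ring n); q \<in> carrier (poly_ring n)\<rbrakk> \<Longrightarrow> p * q \<in> carrier (poly_ring n)"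
proof -
  interpret cring "poly_ring n :: 'k mpoly ring" by (rule poly_ring_cring)
  show "(0 :: 'k mpoly) \<in> carrier (poly_ring n)" using zero_closed by simp
  show "(1 :: 'k mpoly) \<in> carrier (poly_ring n)" using one_closed by simp
  show "\<lbrakk>p \<in> carrier (poly_ring n); q \<in> carrier (poly_ring n)\<rbrakk> \<Longrightarrow> p + q \<in> carrier (poly_ring n)"
    using a_closed[of p q] by simp
  show "\<lbrakk>p \<in> carrier (poly_ring n); q \<in> carrier (poly_ring n)\<rbrakk> \<Longrightarrow> p * q \<in> carrier (poly_ring n)"
    using m_closed[of p q] by simp
  show "\<lbrakk>p \<in> carrier (poly_ring n); q \<in> carrier (poly_ring n)\<rbrakk> \<Longrightarrow> p - q \<in> carrier (poly_ring n)"
  proof -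
    have "Poly_Mapping.keys (p - q) \<subseteq> Poly_Mapping.keys p \<union> Poly_Mapping.keys q"
      by (auto simp: in_keys_iff lookup_minus)
    then show "\<lbrakk>p \<in> carrier (poly_ring n); q \<in> carrier (poly_ring n)\<rbrakk> \<Longrightarrow> p - q \<in> carrier (poly_ring n)"
      unfolding carrier_poly_ring by blast
  qed
qed

lemma a_minus_poly_ring:
  fixes p q :: "'k::field mpoly"
  assumes "p \<in> carrier (poly_ring n)" "q \<in> carrier (poly_ring n)"
  shows "p \<ominus>\<^bsub>poly_ring n\<^esub> q = p - q"
proof -
  interpret cring "poly_ring n :: 'k mpoly ring" by (rule poly_ring_cring)
  have "\<ominus>\<^bsub>poly_ring n\<^esub> q = - q"
    by (rule minus_equality) (use assms poly_ring_diff[of 0 n q] in auto)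
  then show ?thesis by (simp add: a_minus_def)
qed

lemma poly_ring_sum [intro]:
  "(\<And>x. x \<in> A \<Longrightarrow> f x \<in> carrier (poly_ring n)) \<Longrightarrow> sum f A \<in> carrier (poly_ring n)"
  by (induction A rule: infinite_finite_induct) auto

lemma poly_ring_var [intro]: "i \<in> {1..n} \<Longrightarrow> var i \<in> carrier (poly_ring n)"
  by (auto simp: carrier_poly_ring of_mono_def)

lemma poly_ring_restrict_vars [intro]:
  "p \<in> carrier (poly_ring n) \<Longrightarrow> restrict_vars F p \<in> carrier (poly_ring n)"
  by (auto simp: carrier_poly_ring in_keys_iff lookup_restrict_vars split: if_splits)

lemma lookup_var_zero: "Poly_Mapping.lookup (var i) 0 = 0"
proof -
  have "xvar i \<noteq> 0" by (metis keys_xvar keys_zero insert_not_empty)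
  then show ?thesis by (simp add: of_mono_def lookup_single when_def)
qed

lemma graded_max_ideal_subset:
  "(graded_max_ideal n :: 'k::field mpoly set) \<subseteq>
    {p \<in> carrier (poly_ring n). Poly_Mapping.lookup p 0 = 0}"
proof -
  interpret R: cring "poly_ring n :: 'k mpoly ring" by (rule poly_ring_cring)
  have "ideal {p \<in> carrier (poly_ring n). Poly_Mapping.lookup p 0 = (0::'k)} (poly_ring n)"
  proof (rule idealI[OF R.ring_axioms])
    show "subgroup {p \<in> carrier (poly_ring n). Poly_Mapping.lookup p 0 = (0::'k)} (add_monoid (poly_ring n))"
    proof (rule group.subgroupI[OF R.a_group])
      fix a :: "'k mpoly" assume "a \<in> {p \<in> carrier (poly_ring n). Poly_Mapping.lookup p 0 = (0::'k)}"
      then have "a \<in> carrier (poly_ring n)" "Poly_Mapping.lookup a 0 = 0" by auto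
      then show "inv\<^bsub>add_monoid (poly_ring n)\<^esub> a \<in> {p \<in> carrier (poly_ring n). Poly_Mapping.lookup p 0 = (0::'k)}"
        using R.a_inv_closed[of a] a_minus_poly_ring[of 0 n a]
        by (auto simp: a_inv_def a_minus_def)
    qed (auto simp: lookup_add)
  qed (auto simp: lookup_mult_zero)
  then show ?thesis
    unfolding graded_max_ideal_def
    by (rule R.genideal_minimal) (auto simp: lookup_var_zero)
qed

lemma sum_var_in_graded_max_ideal:
  assumes "A \<subseteq> {1..n}"
  shows "(\<Sum>i\<in>A. var i) \<in> (graded_max_ideal n :: 'k::field mpoly set)"
proof -
  interpret R: cring "poly_ring n :: 'k mpoly ring" by (rule poly_ring_cring)
  have gens: "var ` {1..n} \<subseteq> carrier (poly_ring n :: 'k mpoly ring)" by auto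
  interpret ideal "graded_max_ideal n" "poly_ring n :: 'k mpoly ring"
    unfolding graded_max_ideal_def by (rule R.genideal_ideal[OF gens])
  have "var i \<in> (graded_max_ideal n :: 'k mpoly set)" if "i \<in> A" for i
    using R.genideal_self[OF gens] that assms by (auto simp: graded_max_ideal_def)
  then show ?thesis
    using zero_closed a_closed by (induction A rule: infinite_finite_induct) auto
qed

section \<open>Regular sequences on a quotient of the polynomial ring\<close>

text \<open>
  The preimage in the polynomial ring of the submodule $(f_1, \dots, f_r) (S/I)$.
\<close>

definition in_span :: "nat \<Rightarrow> 'k::field mpoly set \<Rightarrow> 'k mpoly list \<Rightarrow> 'k mpoly \<Rightarrow> bool" where
  "in_span n I fs p \<longleftrightarrow>
    (\<exists>q. (\<forall>j<length fs. q j \<in> carrier (poly_ring n)) \<and> p - (\<Sum>j<length fs. fs ! j * q j) \<in> I)"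

lemma in_span_Nil [simp]: "in_span n I [] p \<longleftrightarrow> p \<in> I"
  by (simp add: in_span_def)

lemma in_span_singleton: "in_span n I [f] p \<longleftrightarrow> (\<exists>q\<in>carrier (poly_ring n). p - f * q \<in> I)"
  by (auto simp: in_span_def)

context
  fixes n :: nat and I :: "'k::field mpoly set"
  assumes ideal_I: "ideal I (poly_ring n)"
begin

interpretation R: cring "poly_ring n :: 'k mpoly ring" by (rule poly_ring_cring)
interpretation I: ideal I "poly_ring n" by (rule ideal_I)
interpretation Q: cring "poly_ring n Quot I" by (rule I.quotient_is_cring[OF R.is_cring])
interpretation M: Module.module "poly_ring n" "quot_module (poly_ring n) I"
  by (rule quot_module_module[OF R.is_cring ideal_I])

lemma quot_module_carrier:
  "carrier (quot_module (poly_ring n) I) = (\<lambda>p. I +>\<^bsub>poly_ring n\<^esub> p) ` carrier (poly_ring n)"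
  unfolding quot_module_def FactRing_def A_RCOSETS_def' by auto

lemma quot_module_smult:
  "f \<in> carrier (poly_ring n) \<Longrightarrow> p \<in> carrier (poly_ring n) \<Longrightarrow>
    f \<odot>\<^bsub>quot_module (poly_ring n) I\<^esub> (I +>\<^bsub>poly_ring n\<^esub> p) = I +>\<^bsub>poly_ring n\<^esub> (f * p)"
  using I.rcoset_mult_add[of f p] by (simp add: quot_module_def FactRing_def)

lemma coset_eq_iff:
  assumes "p \<in> carrier (poly_ring n)" "q \<in> carrier (poly_ring n)"
  shows "I +>\<^bsub>poly_ring n\<^esub> p = I +>\<^bsub>poly_ring n\<^esub> q \<longleftrightarrow> p - q \<in> I"
  using R.quotient_eq_iff_same_a_r_cos[OF ideal_I assms] a_minus_poly_ring[OF assms] by simp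

lemma quot_module_finsum:
  assumes "finite A" "\<And>i. i \<in> A \<Longrightarrow> p i \<in> carrier (poly_ring n)"
  shows "(\<Oplus>\<^bsub>quot_module (poly_ring n) I\<^esub>i\<in>A. I +>\<^bsub>poly_ring n\<^esub> p i) = I +>\<^bsub>poly_ring n\<^esub> (\<Sum>i\<in>A. p i)"
  using assms
proof (induction A)
  case empty
  have "\<zero>\<^bsub>quot_module (poly_ring n) I\<^esub> = I +>\<^bsub>poly_ring n\<^esub> 0"
    using R.a_coset_add_zero[of I] I.a_subset by (simp add: quot_module_def FactRing_def)
  then show ?case by simp
next
  case (insert x A)
  then have "(\<Sum>i\<in>A. p i) \<in> carrier (poly_ring n)" by auto
  moreover have "X \<oplus>\<^bsub>quot_module (poly_ring n) I\<^esub> Y = X <+>\<^bsub>poly_ring n\<^esub> Y" for X Y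
    by (simp add: quot_module_def FactRing_def)
  ultimately show ?case
    using insert I.a_rcos_sum[of "p x" "\<Sum>i\<in>A. p i"]
    by (subst M.finsum_insert) (auto simp: quot_module_carrier)
qed

lemma in_list_smult_iff:
  assumes fs: "set fs \<subseteq> carrier (poly_ring n)" and p: "p \<in> carrier (poly_ring n)"
  shows "I +>\<^bsub>poly_ring n\<^esub> p \<in> list_smult (poly_ring n) (quot_module (poly_ring n) I) fs \<longleftrightarrow> in_span n I fs p"
proof -
  let ?M = "quot_module (poly_ring n) I"
  have fs_j: "fs ! j \<in> carrier (poly_ring n)" if "j < length fs" for j
    using fs that by (auto dest: nth_mem)
  have sum: "(\<Oplus>\<^bsub>?M\<^esub>i\<in>{..<length fs}. (fs ! i) \<odot>\<^bsub>?M\<^esub> m i) = I +>\<^bsub>poly_ring n\<^esub> (\<Sum>j<length fs. fs ! j * q j)"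
    if "\<forall>j<length fs. q j \<in> carrier (poly_ring n) \<and> m j = I +>\<^bsub>poly_ring n\<^esub> q j" for m q
  proof -
    have "(\<Oplus>\<^bsub>?M\<^esub>i\<in>{..<length fs}. (fs ! i) \<odot>\<^bsub>?M\<^esub> m i) =
        (\<Oplus>\<^bsub>?M\<^esub>i\<in>{..<length fs}. I +>\<^bsub>poly_ring n\<^esub> (fs ! i * q i))"
      by (rule M.finsum_cong') (use that fs_j in \<open>auto simp: quot_module_smult quot_module_carrier\<close>)
    also have "\<dots> = I +>\<^bsub>poly_ring n\<^esub> (\<Sum>j<length fs. fs ! j * q j)"
      by (rule quot_module_finsum) (use that fs_j in auto)
    finally show ?thesis .
  qed
  have sum_closed: "(\<Sum>j<length fs. fs ! j * q j) \<in> carrier (poly_ring n)"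
    if "\<forall>j<length fs. q j \<in> carrier (poly_ring n)" for q
    using that fs_j by auto
  show ?thesis
  proof
    assume "I +>\<^bsub>poly_ring n\<^esub> p \<in> list_smult (poly_ring n) ?M fs"
    then obtain m where m: "m \<in> {..<length fs} \<rightarrow> carrier ?M"
      and eq: "I +>\<^bsub>poly_ring n\<^esub> p = (\<Oplus>\<^bsub>?M\<^esub>i\<in>{..<length fs}. (fs ! i) \<odot>\<^bsub>?M\<^esub> m i)"
      by (auto simp: list_smult_def)
    from m have "\<forall>j<length fs. \<exists>q\<in>carrier (poly_ring n). m j = I +>\<^bsub>poly_ring n\<^esub> q"
      by (auto simp: quot_module_carrier Pi_iff)
    then obtain q where "\<forall>j<length fs. q j \<in> carrier (poly_ring n) \<and> m j = I +>\<^bsub>poly_ring n\<^esub> q j"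
      by metis
    with eq sum[OF this] sum_closed[of q] p show "in_span n I fs p"
      by (auto simp: coset_eq_iff in_span_def)
  next
    assume "in_span n I fs p"
    then obtain q where q: "\<forall>j<length fs. q j \<in> carrier (poly_ring n)" "p - (\<Sum>j<length fs. fs ! j * q j) \<in> I"
      by (auto simp: in_span_def)
    with p sum_closed[of q] have "I +>\<^bsub>poly_ring n\<^esub> p = I +>\<^bsub>poly_ring n\<^esub> (\<Sum>j<length fs. fs ! j * q j)"
      by (simp add: coset_eq_iff)
    also have "\<dots> = (\<Oplus>\<^bsub>?M\<^esub>i\<in>{..<length fs}. (fs ! i) \<odot>\<^bsub>?M\<^esub> (I +>\<^bsub>poly_ring n\<^esub> q i))"
      by (rule sum[symmetric]) (use q in auto)
    finally show "I +>\<^bsub>poly_ring n\<^esub> p \<in> list_smult (poly_ring n) ?M fs"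
      using q by (auto simp: list_smult_def quot_module_carrier intro!: exI[of _ "\<lambda>i. I +>\<^bsub>poly_ring n\<^esub> q i"])
  qed
qed

text \<open>
  Regularity on $S/I$ becomes a statement about polynomials modulo \<open>I\<close>; cosets do not occur after
  this point.
\<close>

lemma regular_sequence_quot_iff:
  "regular_sequence (poly_ring n) (quot_module (poly_ring n) I) fs \<longleftrightarrow>
    set fs \<subseteq> carrier (poly_ring n) \<and>
    (\<forall>i<length fs. \<forall>p\<in>carrier (poly_ring n).
      in_span n I (take i fs) (fs ! i * p) \<longrightarrow> in_span n I (take i fs) p) \<and>
    (\<exists>p\<in>carrier (poly_ring n). \<not> in_span n I fs p)"
proof (cases "set fs \<subseteq> carrier (poly_ring n)")
  case True
  let ?M = "quot_module (poly_ring n) I" and ?L = "list_smult (poly_ring n) (quot_module (poly_ring n) I)"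
  have "fs ! i \<in> carrier (poly_ring n)" if "i < length fs" for i
    using True that by (auto dest: nth_mem)
  then have *: "(fs ! i) \<odot>\<^bsub>?M\<^esub> (I +>\<^bsub>poly_ring n\<^esub> p) \<in> ?L (take i fs) \<longleftrightarrow> in_span n I (take i fs) (fs ! i * p)"
    "I +>\<^bsub>poly_ring n\<^esub> p \<in> ?L (take i fs) \<longleftrightarrow> in_span n I (take i fs) p"
    if "i < length fs" "p \<in> carrier (poly_ring n)" for i p
    using that True set_take_subset[of i fs] by (subst in_list_smult_iff[symmetric]; auto simp: quot_module_smult)+
  have "?L fs \<subseteq> carrier ?M"
    using True by (auto simp: list_smult_def intro!: M.finsum_closed M.smult_closed dest: nth_mem)
  then have "?L fs \<noteq> carrier ?M \<longleftrightarrow> \<not> (\<forall>p\<in>carrier (poly_ring n). I +>\<^bsub>poly_ring n\<^esub> p \<in> ?L fs)"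
    by (auto simp: quot_module_carrier)
  then have "?L fs \<noteq> carrier ?M \<longleftrightarrow> (\<exists>p\<in>carrier (poly_ring n). \<not> in_span n I fs p)"
    using in_list_smult_iff[OF True] by simp
  with True * show ?thesis
    by (simp add: regular_sequence_def quot_module_carrier)
qed (simp add: regular_sequence_def)

end

section \<open>Edge ideals and independent sets\<close>

definition independent_sets :: "nat \<Rightarrow> (nat \<times> nat) set \<Rightarrow> nat set set" where
  "independent_sets n E = {F. F \<subseteq> {1..n} \<and> (\<forall>(a, b)\<in>E. \<not> (a \<in> F \<and> b \<in> F))}"

definition edge_ideal :: "nat \<Rightarrow> (nat \<times> nat) set \<Rightarrow> 'k::field mpoly set" where
  "edge_ideal n E = Idl\<^bsub>poly_ring n\<^esub> ((\<lambda>(a, b). of_mono (xvar a + xvar b)) ` E)"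

lemma of_mono_add: "of_mono (w + w') = of_mono w * of_mono w'"
  by (simp add: of_mono_def mult_single)

lemma var_nonzero: "var i \<noteq> (0 :: 'k::field mpoly)"
  using sum_var_nonzero[of "{i}"] by simp

lemma independent_sets_mono: "F \<in> independent_sets n E \<Longrightarrow> G \<subseteq> F \<Longrightarrow> G \<in> independent_sets n E"
  by (fastforce simp: independent_sets_def)

text \<open>
  The two sums are coprime when \<open>Q\<close> splits \<open>G\<close> properly. Choose a variable $x_a$ with
  $a \in G - Q$ and substitute for it the negative of the sum of the others: the kernel
  of this homomorphism is the ideal of the first sum, and the second sum is fixed, hence not in it.
\<close>

lemma sum_var_dvd_cancel:
  fixes h :: "'k::field mpoly"
  assumes G: "finite G" "G \<inter> Q \<noteq> {}" "G - Q \<noteq> {}"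
    and dvd: "(\<Sum>i\<in>G. var i) dvd (\<Sum>i\<in>G \<inter> Q. var i) * h"
  shows "(\<Sum>i\<in>G. var i) dvd h"
proof -
  obtain a where a: "a \<in> G" "a \<notin> Q" using G by auto
  define s :: "'k mpoly" where "s = (\<Sum>i\<in>G - {a}. var i)"
  define \<theta> where "\<theta> = var(a := - s)"
  have f: "(\<Sum>i\<in>G. var i) = var a + s"
    using a G by (simp add: s_def sum.remove)
  have subst_id: "poly_subst \<theta> (\<Sum>i\<in>B. var i) = (\<Sum>i\<in>B. var i)" if "a \<notin> B" for B
    using that by (auto simp: poly_subst_sum \<theta>_def intro!: sum.cong)
  have s_fix: "poly_subst \<theta> s = s"
    unfolding s_def by (rule subst_id) simp
  have "poly_subst \<theta> (var a + s) = 0"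
    by (simp add: poly_subst_add s_fix) (simp add: \<theta>_def)
  moreover from dvd obtain k where "(\<Sum>i\<in>G \<inter> Q. var i) * h = (var a + s) * k"
    unfolding f by (rule dvdE)
  ultimately have "poly_subst \<theta> ((\<Sum>i\<in>G \<inter> Q. var i) * h) = 0"
    by (simp only: poly_subst_mult[of _ "var a + s"] mult_zero_left)
  moreover have "poly_subst \<theta> (\<Sum>i\<in>G \<inter> Q. var i) \<noteq> 0"
    using a G by (simp add: subst_id sum_var_nonzero)
  ultimately have "poly_subst \<theta> h = 0"
    by (simp add: poly_subst_mult)
  moreover have "(\<Sum>i\<in>G. var i) dvd h - poly_subst \<theta> h"
    unfolding f by (rule dvd_diff_poly_subst) (auto simp: \<theta>_def)
  ultimately show ?thesis by simp
qed

locale graph_edges =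
  fixes n :: nat and E :: "(nat \<times> nat) set"
  assumes edgeD: "(a, b) \<in> E \<Longrightarrow> a \<in> {1..n} \<and> b \<in> {1..n} \<and> a \<noteq> b"
begin

lemma empty_independent: "{} \<in> independent_sets n E"
  by (auto simp: independent_sets_def)

lemma singleton_independent: "a \<in> {1..n} \<Longrightarrow> {a} \<in> independent_sets n E"
  by (auto simp: independent_sets_def dest: edgeD)

lemma edge_generators_closed:
  "(\<lambda>(a, b). of_mono (xvar a + xvar b)) ` E \<subseteq> carrier (poly_ring n :: 'k::field mpoly ring)"
  using edgeD by (auto simp: of_mono_add poly_ring_mult poly_ring_var)

lemma ideal_edge_ideal: "ideal (edge_ideal n E) (poly_ring n :: 'k::field mpoly ring)"
  unfolding edge_ideal_def
  by (rule ring.genideal_ideal[OF cring.axioms(1)[OF poly_ring_cring] edge_generators_closed])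

text \<open>
  The restrictions to independent sets kill the generators. Conversely, if they all kill \<open>p\<close>, then
  the variables of each monomial of \<open>p\<close> form a set that is not independent (restrict to this set),
  so the monomial is divisible by a generator.
\<close>

lemma edge_ideal_iff:
  fixes p :: "'k::field mpoly"
  shows "p \<in> edge_ideal n E \<longleftrightarrow>
    p \<in> carrier (poly_ring n) \<and> (\<forall>F\<in>independent_sets n E. restrict_vars F p = 0)"
proof
  interpret R: cring "poly_ring n :: 'k mpoly ring" by (rule poly_ring_cring)
  let ?J = "{p \<in> carrier (poly_ring n). \<forall>F\<in>independent_sets n E. restrict_vars F p = (0 :: 'k mpoly)}"
  have "ideal ?J (poly_ring n)"
  proof (rule idealI[OF R.ring_axioms])
    show "subgroup ?J (add_monoid (poly_ring n))"
    proof (rule group.subgroupI[OF R.a_group])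
      fix a assume "a \<in> ?J"
      then show "inv\<^bsub>add_monoid (poly_ring n)\<^esub> a \<in> ?J"
        using R.a_inv_closed[of a] a_minus_poly_ring[of 0 n a] restrict_vars_diff[of _ 0 a]
        by (auto simp: a_inv_def a_minus_def)
    next
      show "?J \<noteq> {}" by (auto intro!: exI[of _ 0])
    qed (auto simp: restrict_vars_add)
  qed (auto simp: restrict_vars_mult)
  moreover have "(\<lambda>(a, b). of_mono (xvar a + xvar b)) ` E \<subseteq> ?J"
    using edge_generators_closed
    by (auto simp: of_mono_add restrict_vars_mult restrict_vars_var independent_sets_def)
  ultimately have "edge_ideal n E \<subseteq> ?J"
    unfolding edge_ideal_def by (rule R.genideal_minimal)
  then show "p \<in> edge_ideal n E \<Longrightarrow>
      p \<in> carrier (poly_ring n) \<and> (\<forall>F\<in>independent_sets n E. restrict_vars F p = 0)"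
    by blast
next
  interpret R: cring "poly_ring n :: 'k mpoly ring" by (rule poly_ring_cring)
  interpret ideal "edge_ideal n E" "poly_ring n :: 'k mpoly ring" by (rule ideal_edge_ideal)
  assume p: "p \<in> carrier (poly_ring n) \<and> (\<forall>F\<in>independent_sets n E. restrict_vars F p = 0)"
  let ?s = "\<lambda>w. Poly_Mapping.single w (Poly_Mapping.lookup p w)"
  have "?s w \<in> edge_ideal n E" if w: "w \<in> Poly_Mapping.keys p" for w
  proof -
    have "Poly_Mapping.lookup (restrict_vars (Poly_Mapping.keys w) p) w \<noteq> 0"
      using w by (simp add: lookup_restrict_vars in_keys_iff)
    then have "Poly_Mapping.keys w \<notin> independent_sets n E"
      using p by force
    moreover have w_V: "Poly_Mapping.keys w \<subseteq> {1..n}"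
      using p w by (auto simp: carrier_poly_ring)
    ultimately obtain a b where ab: "(a, b) \<in> E" "a \<in> Poly_Mapping.keys w" "b \<in> Poly_Mapping.keys w"
      by (auto simp: independent_sets_def)
    define w' where "w' = w - (xvar a + xvar b)"
    have "w = xvar a + xvar b + w'"
      using ab edgeD[OF ab(1)]
      by (intro poly_mapping_eqI)
        (auto simp: w'_def lookup_add lookup_minus xvar_def lookup_single when_def in_keys_iff)
    then have "?s w = of_mono (xvar a + xvar b) * Poly_Mapping.single w' (Poly_Mapping.lookup p w)"
      by (metis of_mono_def mult_single mult_1)
    moreover have "of_mono (xvar a + xvar b) \<in> (edge_ideal n E :: 'k mpoly set)"
      unfolding edge_ideal_def using R.genideal_self[OF edge_generators_closed] ab(1) by force
    moreover have "Poly_Mapping.keys w' \<subseteq> {1..n}"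
      using w_V by (auto simp: w'_def in_keys_iff lookup_minus)
    then have "Poly_Mapping.single w' (Poly_Mapping.lookup p w) \<in> carrier (poly_ring n)"
      by (auto simp: carrier_poly_ring)
    ultimately show ?thesis using I_r_closed by force
  qed
  then have "(\<Sum>w\<in>A. ?s w) \<in> edge_ideal n E" if "A \<subseteq> Poly_Mapping.keys p" for A
    using that zero_closed a_closed by (induction A rule: infinite_finite_induct) auto
  from this[OF order_refl] show "p \<in> edge_ideal n E"
    by (simp only: poly_as_sum[symmetric])
qed

lemma edge_idealD:
  "p \<in> edge_ideal n E \<Longrightarrow> F \<in> independent_sets n E \<Longrightarrow> restrict_vars F p = 0"
  by (simp add: edge_ideal_iff)

lemma lookup_zero_edge_ideal:
  assumes "p \<in> edge_ideal n E"
  shows "Poly_Mapping.lookup p 0 = 0"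
  using edge_idealD[OF assms empty_independent] lookup_restrict_vars[of "{}" p 0] by simp

text \<open>
  This settles the properness condition of regular sequences: in the graded maximal ideal and in the
  edge ideal all constant terms are $0$.
\<close>

lemma one_not_in_span:
  assumes "set fs \<subseteq> graded_max_ideal n"
  shows "\<not> in_span n (edge_ideal n E) fs (1 :: 'k::field mpoly)"
proof
  assume "in_span n (edge_ideal n E) fs (1 :: 'k mpoly)"
  then obtain q where "(1 :: 'k mpoly) - (\<Sum>j<length fs. fs ! j * q j) \<in> edge_ideal n E"
    by (auto simp: in_span_def)
  then have "Poly_Mapping.lookup (1 - (\<Sum>j<length fs. fs ! j * q j)) 0 = 0"
    by (rule lookup_zero_edge_ideal)
  moreover have "Poly_Mapping.lookup (fs ! j) 0 = 0" if "j < length fs" for j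
    using assms graded_max_ideal_subset[of n] nth_mem[OF that] by blast
  then have "Poly_Mapping.lookup (\<Sum>j<length fs. fs ! j * q j) 0 = 0"
    by (simp add: lookup_sum lookup_mult_zero)
  ultimately show False by (simp add: lookup_minus)
qed

lemma regular_sequence_edge_ideal_iff:
  fixes fs :: "'k::field mpoly list"
  assumes "set fs \<subseteq> graded_max_ideal n"
  shows "regular_sequence (poly_ring n) (quot_module (poly_ring n) (edge_ideal n E)) fs \<longleftrightarrow>
    (\<forall>i<length fs. \<forall>p\<in>carrier (poly_ring n).
      in_span n (edge_ideal n E) (take i fs) (fs ! i * p) \<longrightarrow> in_span n (edge_ideal n E) (take i fs) p)"
  using assms graded_max_ideal_subset[of n] one_not_in_span[OF assms]
  unfolding regular_sequence_quot_iff[OF ideal_edge_ideal] by blast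

section \<open>Depth at least one\<close>

lemma sum_var_nonzerodivisor:
  fixes p :: "'k::field mpoly"
  assumes n: "1 \<le> n" and p: "p \<in> carrier (poly_ring n)"
    and fp: "(\<Sum>i\<in>{1..n}. var i) * p \<in> edge_ideal n E"
  shows "p \<in> edge_ideal n E"
proof -
  have *: "restrict_vars F p = 0" if F: "F \<in> independent_sets n E" "F \<noteq> {}" for F
  proof -
    have "F \<subseteq> {1..n}" using F by (auto simp: independent_sets_def)
    moreover from this have "finite F" by (rule finite_subset) simp
    ultimately have "restrict_vars F (\<Sum>i\<in>{1..n}. var i) \<noteq> (0 :: 'k mpoly)"
      using F(2) by (simp add: restrict_vars_sum_var Int_absorb1 sum_var_nonzero)
    with edge_idealD[OF fp F(1)] show ?thesis
      by (simp add: restrict_vars_mult)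
  qed
  moreover have "restrict_vars {} p = 0"
    using *[OF singleton_independent[of 1]] n restrict_vars_restrict_vars[of "{}" "{1}" p] by simp
  ultimately show ?thesis
    using p by (auto simp: edge_ideal_iff)
qed

lemma depth_ge_one:
  assumes "1 \<le> n"
  shows "depth (poly_ring n) (graded_max_ideal n)
      (quot_module (poly_ring n) (edge_ideal n E :: 'k::field mpoly set)) \<ge> 1"
proof -
  let ?f = "\<Sum>i\<in>{1..n}. var i :: 'k mpoly"
  have f: "set [?f] \<subseteq> graded_max_ideal n"
    using sum_var_in_graded_max_ideal[of "{1..n}" n] by simp
  moreover have "regular_sequence (poly_ring n) (quot_module (poly_ring n) (edge_ideal n E)) [?f]"
    using sum_var_nonzerodivisor[OF assms] unfolding regular_sequence_edge_ideal_iff[OF f] by auto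
  ultimately have "enat (length [?f]) \<le> depth (poly_ring n) (graded_max_ideal n)
      (quot_module (poly_ring n) (edge_ideal n E :: 'k mpoly set))"
    unfolding depth_def by (intro SUP_upper) simp
  then show ?thesis by (simp add: one_enat_def)
qed

section \<open>A disconnected complement graph\<close>

text \<open>
  Let $f, g$ be the first two members of a longer sequence, and write $f_A$, $g_A$ for their
  restrictions to \<open>A\<close>. Modulo \<open>I\<close> one has $g f_A = f g_A$, both sides being $f_A g_A$, so regularity
  of $g$ modulo $f$ yields $f_A = f p$. This forces $f (1 - p) = 0$ on the independent sets
  inside \<open>A\<close> and $f p = 0$ on those outside. The constant terms of $p$ and $1 - p$ are not
  both $0$, so $f$ vanishes on one of the two sides and annihilates the variables of that side.
\<close>

lemma length_regular_sequence_le_one: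
  fixes fs :: "'k::field mpoly list"
  assumes A: "A \<subseteq> {1..n}" "A \<noteq> {}" "A \<noteq> {1..n}"
    and sep: "\<And>a b. a \<in> A \<Longrightarrow> b \<in> {1..n} - A \<Longrightarrow> {a, b} \<notin> independent_sets n E"
    and fs: "set fs \<subseteq> graded_max_ideal n"
    and reg: "regular_sequence (poly_ring n) (quot_module (poly_ring n) (edge_ideal n E)) fs"
  shows "length fs \<le> 1"
proof (rule ccontr)
  let ?I = "edge_ideal n E :: 'k mpoly set"
  assume "\<not> length fs \<le> 1"
  then obtain f g gs where fs_eq: "fs = f # g # gs"
    by (cases fs rule: remdups_adj.cases) auto
  from reg fs have reg: "\<And>i p. i < length fs \<Longrightarrow> p \<in> carrier (poly_ring n) \<Longrightarrow>
      in_span n ?I (take i fs) (fs ! i * p) \<Longrightarrow> in_span n ?I (take i fs) p"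
    by (simp add: regular_sequence_edge_ideal_iff)
  have nzd: "p \<in> ?I" if "p \<in> carrier (poly_ring n)" "f * p \<in> ?I" for p
    using reg[of 0 p] that by (simp add: fs_eq)
  have fg: "f \<in> carrier (poly_ring n)" "g \<in> carrier (poly_ring n)"
    "Poly_Mapping.lookup f 0 = 0" "Poly_Mapping.lookup g 0 = 0"
    using fs graded_max_ideal_subset[of n] by (auto simp: fs_eq)
  have side: "F \<subseteq> A \<or> F \<inter> A = {}" if "F \<in> independent_sets n E" for F
  proof (rule ccontr)
    assume "\<not> ?thesis"
    then obtain a b where "a \<in> A" "a \<in> F" "b \<in> F" "b \<notin> A" by auto
    then have "{a, b} \<in> independent_sets n E" "b \<in> {1..n} - A"
      using that independent_sets_mono[OF that, of "{a, b}"] by (auto simp: independent_sets_def)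
    with sep \<open>a \<in> A\<close> show False by blast
  qed
  have empty: "restrict_vars {} h = 0" if "Poly_Mapping.lookup h 0 = 0" for h :: "'k mpoly"
    using that by (intro poly_mapping_eqI) (auto simp: lookup_restrict_vars)
  have "g * restrict_vars A f - f * restrict_vars A g \<in> ?I"
    unfolding edge_ideal_iff
  proof (intro conjI ballI)
    fix F assume "F \<in> independent_sets n E"
    from side[OF this] show "restrict_vars F (g * restrict_vars A f - f * restrict_vars A g) = 0"
      by (auto simp: restrict_vars_diff restrict_vars_mult restrict_vars_restrict_vars Int_absorb2 empty fg)
  qed (use fg in auto)
  then have "in_span n ?I [f] (g * restrict_vars A f)"
    using fg by (auto simp: in_span_singleton)
  then have "in_span n ?I [f] (restrict_vars A f)"
    using reg[of 1 "restrict_vars A f"] fg by (auto simp: fs_eq)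
  then obtain p where p: "p \<in> carrier (poly_ring n)" "restrict_vars A f - f * p \<in> ?I"
    by (auto simp: in_span_singleton)
  have in_A: "restrict_vars F f * (1 - restrict_vars F p) = 0"
    if "F \<in> independent_sets n E" "F \<subseteq> A" for F
    using edge_idealD[OF p(2) that(1)] that(2)
    by (simp add: restrict_vars_diff restrict_vars_mult restrict_vars_restrict_vars Int_absorb2 right_diff_distrib)
  have in_B: "restrict_vars F f * restrict_vars F p = 0"
    if "F \<in> independent_sets n E" "F \<inter> A = {}" for F
    using edge_idealD[OF p(2) that(1)] that(2) fg
    by (simp add: restrict_vars_diff restrict_vars_mult restrict_vars_restrict_vars empty)
  have const: "Poly_Mapping.lookup (restrict_vars F p) 0 = Poly_Mapping.lookup p 0" for F
    by (simp add: lookup_restrict_vars)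
  \<comment> \<open>\<open>f\<close> cannot vanish on all independent sets through a vertex, for then it would kill its variable.\<close>
  have no_vertex: False
    if c: "c \<in> {1..n}" and zero: "\<And>F. F \<in> independent_sets n E \<Longrightarrow> c \<in> F \<Longrightarrow> restrict_vars F f = 0" for c
  proof -
    have c': "var c \<in> carrier (poly_ring n :: 'k mpoly ring)"
      using c by (rule poly_ring_var)
    with zero fg(1) have "f * var c \<in> ?I"
      by (auto simp: edge_ideal_iff restrict_vars_mult restrict_vars_var)
    with c' have "var c \<in> ?I"
      by (rule nzd)
    from edge_idealD[OF this singleton_independent[OF c]] show False
      by (simp add: restrict_vars_var var_nonzero)
  qed
  show False
  proof (cases "Poly_Mapping.lookup p 0 = 0")
    case True
    have "1 - restrict_vars F p \<noteq> 0" for F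
    proof -
      have "Poly_Mapping.lookup (1 - restrict_vars F p) 0 \<noteq> 0"
        using const[of F] True by (simp add: lookup_minus)
      then show ?thesis by force
    qed
    then have "restrict_vars F f = 0" if "F \<in> independent_sets n E" "F \<subseteq> A" for F
      using in_A[OF that] by simp
    moreover obtain a where "a \<in> A" using A by auto
    ultimately show False
      using no_vertex[of a] side A by blast
  next
    case False
    have "restrict_vars F p \<noteq> 0" for F
      using const[of F] False by force
    then have "restrict_vars F f = 0" if "F \<in> independent_sets n E" "F \<inter> A = {}" for F
      using in_B[OF that] by simp
    moreover obtain b where "b \<in> {1..n}" "b \<notin> A" using A by blast
    ultimately show False
      using no_vertex[of b] side A by blast
  qed
qed

section \<open>A connected complement graph\<close>

text \<open>
  The gluing argument: \<open>t G\<close> is the quotient of $h$ by $f$ on a set \<open>G\<close> that meets both \<open>Q\<close> and its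
  complement, and \<open>\<Gamma> F\<close> is such a set containing \<open>F\<close>. The coefficient of $p$ at a monomial is taken
  from the quotient on \<open>\<Gamma>\<close> of its set of variables; agreement of the quotients makes this choice
  immaterial.
\<close>

lemma regular_sequence_sum_vars:
  fixes Q :: "nat set"
  defines "f \<equiv> \<Sum>i\<in>{1..n}. var i :: 'k::field mpoly" and "g \<equiv> \<Sum>i\<in>Q. var i"
  assumes n: "1 \<le> n" and Q: "Q \<subseteq> {1..n}"
    and ext: "\<And>F. F \<in> independent_sets n E \<Longrightarrow>
      \<exists>G\<in>independent_sets n E. F \<subseteq> G \<and> G \<inter> Q \<noteq> {} \<and> G - Q \<noteq> {}"
    and conn: "\<And>A. A \<subseteq> {1..n} \<Longrightarrow> A \<noteq> {} \<Longrightarrow> A \<noteq> {1..n} \<Longrightarrow>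
      \<exists>a\<in>A. \<exists>b\<in>{1..n} - A. {a, b} \<in> independent_sets n E"
  shows "regular_sequence (poly_ring n) (quot_module (poly_ring n) (edge_ideal n E)) [f, g]"
proof -
  let ?I = "edge_ideal n E :: 'k mpoly set"
  have fg_in: "set [f, g] \<subseteq> graded_max_ideal n"
    using sum_var_in_graded_max_ideal[OF Q] sum_var_in_graded_max_ideal[of "{1..n}" n]
    by (simp add: f_def g_def)
  then have fg: "f \<in> carrier (poly_ring n)" "g \<in> carrier (poly_ring n)"
    using graded_max_ideal_subset[of n] by auto
  define good where "good = {G \<in> independent_sets n E. G \<inter> Q \<noteq> {} \<and> G - Q \<noteq> {}}"
  have indep_sub: "F \<subseteq> {1..n}" "finite F" if "F \<in> independent_sets n E" for F
    using that finite_subset[of F "{1..n}"] by (auto simp: independent_sets_def)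
  have f_F: "restrict_vars F f = (\<Sum>i\<in>F. var i)" if "F \<subseteq> {1..n}" for F
    using that by (simp add: f_def restrict_vars_sum_var Int_absorb1)
  have f_F_nonzero: "restrict_vars F f \<noteq> 0" if "F \<in> independent_sets n E" "F \<noteq> {}" for F
    using indep_sub[OF that(1)] that(2) by (simp add: f_F sum_var_nonzero)
  have "in_span n ?I [f] h" if h: "h \<in> carrier (poly_ring n)" and gh: "in_span n ?I [f] (g * h)" for h
  proof -
    from gh obtain q where q: "g * h - f * q \<in> ?I"
      by (auto simp: in_span_singleton)
    have "\<exists>t. restrict_vars G h = restrict_vars G f * t \<and> restrict_vars G t = t" if G: "G \<in> good" for G
    proof -
      have G': "G \<in> independent_sets n E" "G \<inter> Q \<noteq> {}" "G - Q \<noteq> {}" "finite G" "G \<subseteq> {1..n}"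
        using G indep_sub[of G] by (auto simp: good_def)
      have "restrict_vars G g * restrict_vars G h = restrict_vars G f * restrict_vars G q"
        using edge_idealD[OF q G'(1)] by (simp add: restrict_vars_diff restrict_vars_mult)
      moreover have "restrict_vars G g = (\<Sum>i\<in>G \<inter> Q. var i)"
        using finite_subset[OF Q] by (simp add: g_def restrict_vars_sum_var Int_commute)
      ultimately have "(\<Sum>i\<in>G. var i) dvd (\<Sum>i\<in>G \<inter> Q. var i) * restrict_vars G h"
        using G' by (simp add: f_F)
      then have "(\<Sum>i\<in>G. var i) dvd restrict_vars G h"
        by (rule sum_var_dvd_cancel[OF G'(4,2,3)])
      then obtain t where "restrict_vars G h = restrict_vars G f * t"
        using G' by (auto simp: f_F elim!: dvdE)
      moreover from arg_cong[OF this, of "restrict_vars G"]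
      have "restrict_vars G h = restrict_vars G f * restrict_vars G t"
        by (simp add: restrict_vars_mult restrict_vars_restrict_vars)
      ultimately show ?thesis
        by (intro exI[of _ "restrict_vars G t"]) (simp add: restrict_vars_restrict_vars)
    qed
    then obtain t where t: "\<And>G. G \<in> good \<Longrightarrow> restrict_vars G h = restrict_vars G f * t G"
      and t_in: "\<And>G. G \<in> good \<Longrightarrow> restrict_vars G (t G) = t G"
      by metis
    \<comment> \<open>The restriction of \<open>f\<close> to a nonempty independent set is nonzero and cancels. On the empty set it
      is $0$, which is why the constant terms need connectedness.\<close>
    have t_agree: "restrict_vars F (t G) = restrict_vars F (t G')"
      if "G \<in> good" "G' \<in> good" "F \<noteq> {}" "F \<subseteq> G" "F \<subseteq> G'" for F G G'
    proof -
      have "F \<in> independent_sets n E"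
        using that independent_sets_mono[of G] by (auto simp: good_def)
      then have "restrict_vars F f \<noteq> 0"
        using that f_F_nonzero by simp
      moreover have "restrict_vars F h = restrict_vars F f * restrict_vars F (t G)"
        if "G \<in> good" "F \<subseteq> G" for G
        using arg_cong[OF t[OF that(1)], of "restrict_vars F"] that(2)
        by (simp add: restrict_vars_mult restrict_vars_restrict_vars Int_absorb2)
      ultimately show ?thesis
        using that by (metis mult_left_cancel)
    qed
    obtain \<Gamma> where \<Gamma>: "\<And>F. F \<in> independent_sets n E \<Longrightarrow> \<Gamma> F \<in> good \<and> F \<subseteq> \<Gamma> F"
      using ext unfolding good_def by (metis (mono_tags, lifting) mem_Collect_eq)
    \<comment> \<open>Every quotient on a set through the vertex \<open>a\<close> has constant term \<open>c a\<close>, and \<open>c\<close> is constant along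
      the edges of the complement graph.\<close>
    define c where "c a = Poly_Mapping.lookup (t (\<Gamma> {a})) 0" for a
    have c_good: "Poly_Mapping.lookup (t G) 0 = c a" if "G \<in> good" "a \<in> G" for G a
    proof -
      have "a \<in> {1..n}" using that indep_sub[of G] by (auto simp: good_def)
      then have "restrict_vars {a} (t G) = restrict_vars {a} (t (\<Gamma> {a}))"
        using t_agree[of G "\<Gamma> {a}" "{a}"] \<Gamma>[OF singleton_independent] that by auto
      from arg_cong[OF this, of "\<lambda>p. Poly_Mapping.lookup p 0"] show ?thesis
        by (simp add: lookup_restrict_vars c_def)
    qed
    have c_const: "c a = c 1" if "a \<in> {1..n}" for a
    proof (rule ccontr)
      define A where "A = {b \<in> {1..n}. c b = c 1}"
      assume "c a \<noteq> c 1"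
      then have "a \<notin> A" by (simp add: A_def)
      with that have "A \<noteq> {1..n}" by metis
      moreover have "1 \<in> A" using n by (simp add: A_def)
      then have "A \<noteq> {}" by fast
      moreover have "A \<subseteq> {1..n}" unfolding A_def by (rule Collect_subset)
      ultimately have "\<exists>a\<in>A. \<exists>b\<in>{1..n} - A. {a, b} \<in> independent_sets n E"
        by (intro conn)
      then obtain a' b' where ab: "a' \<in> A" "b' \<in> {1..n} - A" "{a', b'} \<in> independent_sets n E"
        by (elim bexE)
      with \<Gamma>[OF ab(3)] have "c a' = c b'"
        using c_good[of "\<Gamma> {a', b'}" a'] c_good[of "\<Gamma> {a', b'}" b'] by simp
      with ab show False by (auto simp: A_def)
    qed
    let ?coeff = "\<lambda>w. if Poly_Mapping.keys w \<in> independent_sets n E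
      then Poly_Mapping.lookup (t (\<Gamma> (Poly_Mapping.keys w))) w else 0"
    define p where "p = Abs_poly_mapping ?coeff"
    have "finite (independent_sets n E)"
      by (rule finite_subset[of _ "Pow {1..n}"]) (auto simp: independent_sets_def)
    then have "finite {w. ?coeff w \<noteq> 0}"
      by (intro finite_subset[of "{w. ?coeff w \<noteq> 0}" "\<Union>F\<in>independent_sets n E. Poly_Mapping.keys (t (\<Gamma> F))"])
        (auto simp: in_keys_iff split: if_splits)
    then have lookup_p: "Poly_Mapping.lookup p = ?coeff"
      by (simp add: p_def)
    have p_carrier: "p \<in> carrier (poly_ring n)"
      unfolding carrier_poly_ring
    proof
      fix w assume "w \<in> Poly_Mapping.keys p"
      then have "Poly_Mapping.keys w \<in> independent_sets n E"
        by (simp add: in_keys_iff lookup_p split: if_splits)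
      then show "Poly_Mapping.keys w \<subseteq> {1..n}" by (rule indep_sub)
    qed
    have p_good: "restrict_vars G p = t G" if G: "G \<in> good" for G
    proof (rule poly_mapping_eqI)
      fix w
      have G': "G \<in> independent_sets n E" using G by (simp add: good_def)
      show "Poly_Mapping.lookup (restrict_vars G p) w = Poly_Mapping.lookup (t G) w"
      proof (cases "Poly_Mapping.keys w \<subseteq> G")
        case False
        with t_in[OF G] show ?thesis
          by (metis lookup_restrict_vars)
      next
        case True
        let ?F = "Poly_Mapping.keys w"
        have F: "?F \<in> independent_sets n E" by (rule independent_sets_mono[OF G' True])
        have "Poly_Mapping.lookup (t (\<Gamma> ?F)) w = Poly_Mapping.lookup (t G) w"
        proof (cases "?F = {}")
          case False
          with t_agree[of "\<Gamma> ?F" G ?F] \<Gamma>[OF F] G True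
          have "restrict_vars ?F (t (\<Gamma> ?F)) = restrict_vars ?F (t G)" by auto
          from arg_cong[OF this, of "\<lambda>p. Poly_Mapping.lookup p w"] show ?thesis
            by (simp add: lookup_restrict_vars)
        next
          case True
          then have "w = 0" by simp
          have "Poly_Mapping.lookup (t H) 0 = c 1" if "H \<in> good" for H
          proof -
            obtain a where a: "a \<in> H" using \<open>H \<in> good\<close> by (auto simp: good_def)
            have "a \<in> {1..n}" using a \<open>H \<in> good\<close> indep_sub[of H] by (auto simp: good_def)
            with c_good[OF that a] show ?thesis using c_const[of a] by (simp only:)
          qed
          with \<Gamma>[OF F] G \<open>w = 0\<close> show ?thesis by simp
        qed
        with True F show ?thesis by (simp add: lookup_restrict_vars lookup_p)
      qed
    qed
    have "h - f * p \<in> ?I"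
      unfolding edge_ideal_iff
    proof (intro conjI ballI)
      fix F assume F: "F \<in> independent_sets n E"
      have "restrict_vars (\<Gamma> F) (h - f * p) = 0"
        using \<Gamma>[OF F] by (simp add: restrict_vars_diff restrict_vars_mult t p_good)
      from arg_cong[OF this, of "restrict_vars F"] show "restrict_vars F (h - f * p) = 0"
        using \<Gamma>[OF F] by (simp add: restrict_vars_restrict_vars Int_absorb2)
    qed (use h fg p_carrier in auto)
    with p_carrier show ?thesis by (auto simp: in_span_singleton)
  qed
  moreover have "p \<in> ?I" if "p \<in> carrier (poly_ring n)" "f * p \<in> ?I" for p
    using sum_var_nonzerodivisor[OF n] that by (simp add: f_def)
  ultimately show ?thesis
    unfolding regular_sequence_edge_ideal_iff[OF fg_in]
    by (auto simp: less_Suc_eq)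
qed

end

section \<open>The graph of a lexsegment\<close>

lemma lookup_xvar_add:
  "Poly_Mapping.lookup (xvar a + xvar b) k = (if k = a then 1 else 0) + (if k = b then 1 else 0)"
  by (simp add: lookup_add xvar_def lookup_single when_def)

lemma pair_mono_le_iff:
  assumes "a < b" "c < d"
  shows "xvar a + xvar b \<le> xvar c + xvar d \<longleftrightarrow> c < a \<or> (c = a \<and> d \<le> b)"
proof -
  have less: "xvar a + xvar b < xvar c + xvar d"
    if "c < a \<or> (c = a \<and> d < b)" "a < b" "c < d" for a b c d
  proof (cases "c < a")
    case True
    with that show ?thesis
      unfolding mono_less_iff lookup_xvar_add by (intro exI[of _ c]) auto
  next
    case False
    with that show ?thesis
      unfolding mono_less_iff lookup_xvar_add by (intro exI[of _ d]) auto
  qed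
  show ?thesis
    using less[of c a d b] less[of a c b d] assms
    by (metis less_linear linorder_not_less order_less_imp_le order_refl)
qed

lemma squarefree_monomials_two:
  "squarefree_monomials n 2 = {xvar a + xvar b | a b. 1 \<le> a \<and> a < b \<and> b \<le> n}"
proof (intro equalityI subsetI)
  fix w assume "w \<in> squarefree_monomials n 2"
  then have keys: "Poly_Mapping.keys w \<subseteq> {1..n}" and le: "\<And>i. Poly_Mapping.lookup w i \<le> 1"
    and sum: "(\<Sum>i=1..n. Poly_Mapping.lookup w i) = 2"
    by (auto simp: squarefree_monomials_def monomials_def)
  have one: "Poly_Mapping.lookup w i = 1" if "i \<in> Poly_Mapping.keys w" for i
    using le[of i] that by (simp add: in_keys_iff)
  have "(\<Sum>i=1..n. Poly_Mapping.lookup w i) = (\<Sum>i\<in>Poly_Mapping.keys w. Poly_Mapping.lookup w i)"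
    using keys by (intro sum.mono_neutral_right) (auto simp: in_keys_iff)
  with sum one have "card (Poly_Mapping.keys w) = 2" by simp
  then obtain a b where ab: "Poly_Mapping.keys w = {a, b}" "a < b"
    by (metis card_2_iff insert_commute linorder_neqE_nat)
  have "w = xvar a + xvar b"
  proof (rule poly_mapping_eqI)
    fix k
    show "Poly_Mapping.lookup w k = Poly_Mapping.lookup (xvar a + xvar b) k"
      using one[of k] ab not_in_keys_iff_lookup_eq_zero[of k w] by (auto simp: lookup_xvar_add)
  qed
  with ab keys show "w \<in> {xvar a + xvar b | a b. 1 \<le> a \<and> a < b \<and> b \<le> n}" by auto
next
  fix w assume "w \<in> {xvar a + xvar b | a b. 1 \<le> a \<and> a < b \<and> b \<le> n}"
  then obtain a b where ab: "w = xvar a + xvar b" "1 \<le> a" "a < b" "b \<le> n" by auto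
  have "Poly_Mapping.keys w \<subseteq> {1..n}"
    using ab Poly_Mapping.keys_add[of "xvar a" "xvar b"] by auto
  then show "w \<in> squarefree_monomials n 2"
    using ab by (auto simp: squarefree_monomials_def monomials_def lookup_xvar_add sum.distrib)
qed

text \<open>
  The condition \<open>a = 1 \<longrightarrow> i \<le> b\<close> is $x_a x_b \leq x_1 x_i$, and the last one is
  $x_a x_b \geq x_j x_r$.
\<close>

definition segment_edges :: "nat \<Rightarrow> nat \<Rightarrow> nat \<Rightarrow> nat \<Rightarrow> (nat \<times> nat) set" where
  "segment_edges n i j r =
    {(a, b). 1 \<le> a \<and> a < b \<and> b \<le> n \<and> (a = 1 \<longrightarrow> i \<le> b) \<and> (a < j \<or> (a = j \<and> b \<le> r))}"

lemma graph_edges_segment: "graph_edges n (segment_edges n i j r)"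
  by unfold_locales (auto simp: segment_edges_def)

lemma lex_segment_ideal_eq_edge_ideal:
  assumes "1 < i" "2 \<le> j" "j < r"
  shows "lex_segment_ideal n (xvar 1 + xvar i) (xvar j + xvar r) = edge_ideal n (segment_edges n i j r)"
proof -
  have iff: "(1 \<le> a \<and> a < b \<and> b \<le> n) \<and>
      xvar a + xvar b \<le> xvar 1 + xvar i \<and> xvar j + xvar r \<le> xvar a + xvar b \<longleftrightarrow>
      (a, b) \<in> segment_edges n i j r" for a b
    using assms pair_mono_le_iff[of a b 1 i] pair_mono_le_iff[of j r a b]
    by (cases "a < b") (auto simp: segment_edges_def)
  have "lex_segment n (xvar 1 + xvar i) (xvar j + xvar r) = {xvar a + xvar b | a b.
      (1 \<le> a \<and> a < b \<and> b \<le> n) \<and>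
      xvar a + xvar b \<le> xvar 1 + xvar i \<and> xvar j + xvar r \<le> xvar a + xvar b}"
    unfolding lex_segment_def squarefree_monomials_two by blast
  also have "\<dots> = (\<lambda>(a, b). xvar a + xvar b) ` segment_edges n i j r"
    unfolding iff by auto
  finally have "lex_segment n (xvar 1 + xvar i) (xvar j + xvar r) =
      (\<lambda>(a, b). xvar a + xvar b) ` segment_edges n i j r" .
  then show ?thesis
    by (simp add: lex_segment_ideal_def edge_ideal_def image_image case_prod_unfold)
qed

lemma doubleton_independent_iff:
  "a < b \<Longrightarrow> {a, b} \<in> independent_sets n (segment_edges n i j r) \<longleftrightarrow>
    1 \<le> a \<and> b \<le> n \<and> (a, b) \<notin> segment_edges n i j r"
  by (auto simp: independent_sets_def segment_edges_def)

text \<open>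
  In the complement graph $1$ is joined to $2, \dots, i-1$, then $i - 1$ to $n$, and $n$ to every
  vertex from $i$ on.
\<close>

lemma segment_complement_connected:
  assumes "1 < i" "i \<le> n" "2 \<le> j" "j < r" "r \<le> n" "j \<le> i - 1" "i - 1 = j \<Longrightarrow> r < n"
    and A: "A \<subseteq> {1..n}" "A \<noteq> {}" "A \<noteq> {1..n}"
  shows "\<exists>a\<in>A. \<exists>b\<in>{1..n} - A. {a, b} \<in> independent_sets n (segment_edges n i j r)"
proof (rule ccontr)
  assume no: "\<not> ?thesis"
  have same: "a \<in> A \<longleftrightarrow> b \<in> A"
    if "a < b" "1 \<le> a" "b \<le> n" "(a, b) \<notin> segment_edges n i j r" for a b
  proof -
    have "{a, b} \<in> independent_sets n (segment_edges n i j r)" "{b, a} \<in> independent_sets n (segment_edges n i j r)"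
      using that doubleton_independent_iff[of a b] by (simp_all add: insert_commute)
    moreover have "a \<in> {1..n}" "b \<in> {1..n}" using that by auto
    ultimately show ?thesis
      using no by blast
  qed
  have 1: "i - 1 \<in> A \<longleftrightarrow> n \<in> A"
    by (rule same) (use assms in \<open>auto simp: segment_edges_def\<close>)
  have 2: "1 \<in> A \<longleftrightarrow> k \<in> A" if "2 \<le> k" "k \<le> i - 1" for k
    by (rule same) (use assms that in \<open>auto simp: segment_edges_def\<close>)
  have 3: "k \<in> A \<longleftrightarrow> n \<in> A" if "i \<le> k" "k < n" for k
    by (rule same) (use assms that in \<open>auto simp: segment_edges_def\<close>)
  have all: "k \<in> A \<longleftrightarrow> n \<in> A" if k: "1 \<le> k" "k \<le> n" for k
  proof -
    consider "k = 1" | "2 \<le> k" "k \<le> i - 1" | "i \<le> k" "k < n" | "k = n" using k by linarith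
    then show ?thesis
      using 1 2[of "i - 1"] 2[of k] 3[of k] assms by cases auto
  qed
  show False
  proof (cases "n \<in> A")
    case True
    with all have "{1..n} \<subseteq> A" by auto
    with A(1) have "A = {1..n}" by (rule subset_antisym)
    with A(3) show False by contradiction
  next
    case False
    obtain k where "k \<in> A" using A(2) by (meson ex_in_conv)
    moreover from subsetD[OF A(1) this] have "k \<in> A \<longleftrightarrow> n \<in> A" by (intro all) simp_all
    ultimately show False using False by simp
  qed
qed

text \<open>
  An independent set inside \<open>{2..n - 1}\<close> extends by \<open>1\<close> if all its elements are below \<open>i\<close>. If it
  contains some $b \geq i$, it extends by \<open>n\<close>: its elements are at least \<open>j\<close>, and \<open>j\<close> itself can
  occur only when $b > r$, in which case $\{j, n\}$ is independent too. Both \<open>1\<close> and \<open>n\<close> are joined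
  to \<open>i - 1\<close>, which serves the sets that miss \<open>{2..n - 1}\<close>.
\<close>

lemma segment_independent_extends:
  assumes "1 < i" "i \<le> n" "2 \<le> j" "j < r" "r \<le> n" "j \<le> i - 1" "i - 1 = j \<Longrightarrow> r < n"
    and F: "F \<in> independent_sets n (segment_edges n i j r)"
  shows "\<exists>G\<in>independent_sets n (segment_edges n i j r).
    F \<subseteq> G \<and> G \<inter> {2..n - 1} \<noteq> {} \<and> G - {2..n - 1} \<noteq> {}"
proof -
  have F_sub: "F \<subseteq> {1..n}" using F by (simp add: independent_sets_def)
  have F_edge: "(a, b) \<notin> segment_edges n i j r" if "a \<in> F" "b \<in> F" for a b
    using F that by (auto simp: independent_sets_def)
  have insert_indep: "insert c H \<in> independent_sets n (segment_edges n i j r)"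
    if "H \<in> independent_sets n (segment_edges n i j r)" "c \<in> {1..n}"
      "\<And>a. a \<in> H \<Longrightarrow> (a, c) \<notin> segment_edges n i j r \<and> (c, a) \<notin> segment_edges n i j r" for c H
    using that by (auto simp: independent_sets_def segment_edges_def)
  have i_pred: "i - 1 \<in> {2..n - 1}" and ends: "1 \<notin> {2..n - 1}" "n \<notin> {2..n - 1}"
    using assms by auto
  have one: "(1, k) \<notin> segment_edges n i j r \<and> (k, 1) \<notin> segment_edges n i j r" if "k < i" for k
    using that by (auto simp: segment_edges_def)
  have last: "(i - 1, n) \<notin> segment_edges n i j r" "(n, k) \<notin> segment_edges n i j r" for k
    using assms by (auto simp: segment_edges_def)
  have edge_1n: "(1, n) \<in> segment_edges n i j r"
    using assms by (auto simp: segment_edges_def)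
  have singleton: "{c} \<in> independent_sets n (segment_edges n i j r)" if "c \<in> {1..n}" for c
    by (rule graph_edges.singleton_independent[OF graph_edges_segment that])
  consider "F \<subseteq> {1}" | "F = {n}" | "F \<inter> {2..n - 1} \<noteq> {}" "F - {2..n - 1} \<noteq> {}"
    | "F \<noteq> {}" "F \<subseteq> {2..i - 1}" | b where "b \<in> F" "i \<le> b" "F \<subseteq> {2..n - 1}"
  proof (cases "F \<subseteq> {2..n - 1}")
    case True
    show thesis
    proof (cases "F \<subseteq> {2..i - 1}")
      case True
      then show thesis using that(1,4) by blast
    next
      case False
      then obtain b where "b \<in> F" "b \<notin> {2..i - 1}" by blast
      with True that(5)[of b] show thesis by fastforce
    qed
  next
    case False
    show thesis
    proof (cases "F \<inter> {2..n - 1} = {}")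
      case True
      have "k = 1 \<or> k = n" if "k \<in> F" for k
        using F_sub True that by fastforce
      moreover have "\<not> (1 \<in> F \<and> n \<in> F)"
        using F_edge edge_1n by blast
      ultimately have "F \<subseteq> {1} \<or> F = {n}"
        by blast
      then show thesis using that(1,2) by blast
    next
      case ne: False
      with False show thesis using that(3) by blast
    qed
  qed
  then show ?thesis
  proof cases
    case 1
    have "insert 1 {i - 1} \<in> independent_sets n (segment_edges n i j r)"
      using one[of "i - 1"] assms by (intro insert_indep singleton) auto
    then show ?thesis
      by (rule bexI[rotated]) (use 1 i_pred ends in auto)
  next
    case 2
    have "insert n {i - 1} \<in> independent_sets n (segment_edges n i j r)"
      using last assms by (intro insert_indep singleton) auto
    then show ?thesis
      by (rule bexI[rotated]) (use 2 i_pred ends in auto)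
  next
    case 3
    with F show ?thesis by blast
  next
    case 4
    have "insert 1 F \<in> independent_sets n (segment_edges n i j r)"
      by (intro insert_indep F) (use 4 one assms in fastforce)+
    moreover have "F \<subseteq> {2..n - 1}" using 4 \<open>i \<le> n\<close> by fastforce
    ultimately show ?thesis using 4 ends by blast
  next
    case 5
    have "(a, n) \<notin> segment_edges n i j r" if "a \<in> F" for a
      using F_edge[OF that \<open>b \<in> F\<close>] 5 assms that by (cases "a < b") (auto simp: segment_edges_def)
    then have "insert n F \<in> independent_sets n (segment_edges n i j r)"
      using last assms by (intro insert_indep F) auto
    with 5 ends show ?thesis by blast
  qed
qed

section \<open>The depth of a lexsegment quotient\<close>

theorem proposition3p2p3:
  fixes n i j r :: nat
  defines "u \<equiv> xvar 1 + xvar i"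
    and "v \<equiv> xvar j + xvar r"
    and "S \<equiv> (poly_ring n :: 'k::field mpoly ring)"
  assumes "1 < i" and "i \<le> n"
    and "2 \<le> j" and "j < r" and "r \<le> n"
  shows "depth S (graded_max_ideal n) (quot_module S (lex_segment_ideal n u v)) = 1
    \<longleftrightarrow> xvar (i - 1) + xvar n \<ge> v"
proof -
  interpret graph_edges n "segment_edges n i j r" by (rule graph_edges_segment)
  let ?I = "edge_ideal n (segment_edges n i j r) :: 'k mpoly set"
  let ?d = "depth S (graded_max_ideal n) (quot_module S ?I)"
  have I: "lex_segment_ideal n u v = ?I"
    unfolding u_def v_def by (rule lex_segment_ideal_eq_edge_ideal) fact+
  have cond: "xvar (i - 1) + xvar n \<ge> v \<longleftrightarrow> i - 1 < j \<or> (i - 1 = j \<and> n \<le> r)"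
    unfolding v_def by (rule pair_mono_le_iff) (use assms in auto)
  show ?thesis
    unfolding I cond
  proof
    assume sep: "i - 1 < j \<or> (i - 1 = j \<and> n \<le> r)"
    have "length fs \<le> 1"
      if fs: "set fs \<subseteq> graded_max_ideal n" "regular_sequence S (quot_module S ?I) fs" for fs
    proof (rule length_regular_sequence_le_one[where A = "{1..i - 1}" and fs = fs])
      show "{a, b} \<notin> independent_sets n (segment_edges n i j r)"
        if "a \<in> {1..i - 1}" "b \<in> {1..n} - {1..i - 1}" for a b
        using that sep assms(4-) by (subst doubleton_independent_iff) (auto simp: segment_edges_def)
    qed (use fs assms(4-) in \<open>auto simp: S_def\<close>)
    then have "?d \<le> 1"
      unfolding depth_def by (intro SUP_least) (auto simp: one_enat_def)
    moreover have "?d \<ge> 1"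
      unfolding S_def by (rule depth_ge_one) (use assms(4-) in auto)
    ultimately show "?d = 1" by (rule antisym)
  next
    assume d: "?d = 1"
    show "i - 1 < j \<or> (i - 1 = j \<and> n \<le> r)"
    proof (rule ccontr)
      assume "\<not> ?thesis"
      then have *: "j \<le> i - 1" "i - 1 = j \<Longrightarrow> r < n" by auto
      let ?fs = "[\<Sum>k\<in>{1..n}. var k, \<Sum>k\<in>{2..n - 1}. var k] :: 'k mpoly list"
      have "regular_sequence S (quot_module S ?I) ?fs"
        unfolding S_def
      proof (rule regular_sequence_sum_vars)
        show "\<exists>G\<in>independent_sets n (segment_edges n i j r). F \<subseteq> G \<and> G \<inter> {2..n - 1} \<noteq> {} \<and> G - {2..n - 1} \<noteq> {}"
          if "F \<in> independent_sets n (segment_edges n i j r)" for F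
          by (rule segment_independent_extends) (fact | rule *, assumption)+
        show "\<exists>a\<in>A. \<exists>b\<in>{1..n} - A. {a, b} \<in> independent_sets n (segment_edges n i j r)"
          if "A \<subseteq> {1..n}" "A \<noteq> {}" "A \<noteq> {1..n}" for A
          by (rule segment_complement_connected) (fact | rule *, assumption)+
      qed (use assms(4-) in auto)
      moreover have "set ?fs \<subseteq> graded_max_ideal n"
        using sum_var_in_graded_max_ideal[of "{1..n}" n] sum_var_in_graded_max_ideal[of "{2..n - 1}" n] by auto
      ultimately have "enat (length ?fs) \<le> ?d"
        unfolding depth_def by (intro SUP_upper) simp
      with d show False by (simp add: one_enat_def)
    qed
  qed
qed

end
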